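(* Let $G$ be an infinite finitely generated residually finite group with finite periodic asymptotic dimension. Then every contractible $G$-subshift has dense periodic points, i.e. if $X \subset A^G$ is a contractible subshift, then the set of points of $X$ with finite-index stabilizer in $G$ is dense in $X$.
   Context: For a finite set $A$ (alphabet) and a group $G$, $A^G$ carries the product topology (discrete $A$) and the shift action $(gx)_h = x_{g^{-1}h}$. A subshift is a topologically closed, shift-invariant subset $X \subset A^G$. A block map between $G$-subshifts is a continuous shift-commuting map; products carry the diagonal action. Let $I = \{0,1\}^G$, and let $\bar 0, \bar 1 \in I$ be the constant configurations. A subshift $X$ is contractible if there is a block map $h : I \times X \times X \to X$ with $h(\bar 0, x, y) = x$ and $h(\bar 1, x, y) = y$ for all $x, y \in X$. A configuration is periodic if its stabilizer under the shift action has finite index in $G$ (equivalently, its shift orbit is finite). Periodic asymptotic dimension: fix a finite symmetric generating set of $G$ with word norm $|\cdot|$. For $n, r, m \in \mathbb{N}$ let $X_{n,r,m} \subset \{1,\ldots,n\}^G$ be the set of $x$ such that for each color $c \in \{1,\ldots,n\}$, the graph with vertex set $\{a \in G : x_a = c\}$ and edges $\{(a,b) : x_a = x_b = c,\ |a^{-1}b| \leq r\}$ has all connected components of cardinality at most $m$. The periodic asymptotic dimension $\mathrm{pdim}(G)$ is the infimum of all $d \in \mathbb{N}$ such that for all $r$ there exists $m$ such that $X_{d+1,r,m}$ contains a periodic point (it is $\infty$ if no such $d$ exists). It does not depend on the choice of finite generating set. *)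

theory Defs
  imports "HOL-Algebra.Group_Action" "HOL-Algebra.Generated_Groups" "HOL-Analysis.Analysis" "HOL-Library.Extended_Nat"
begin

(* Configurations are extensional functions on the carrier of G. *)

definition full_shift :: "('g, 'b) monoid_scheme \<Rightarrow> 'a set \<Rightarrow> ('g \<Rightarrow> 'a) topology" where
  "full_shift G A = product_topology (\<lambda>_. discrete_topology A) (carrier G)"

definition shift :: "('g, 'b) monoid_scheme \<Rightarrow> 'g \<Rightarrow> ('g \<Rightarrow> 'a) \<Rightarrow> ('g \<Rightarrow> 'a)" where
  "shift G g x = (\<lambda>h \<in> carrier G. x (inv\<^bsub>G\<^esub> g \<otimes>\<^bsub>G\<^esub> h))"

definition subshift :: "('g, 'b) monoid_scheme \<Rightarrow> 'a set \<Rightarrow> ('g \<Rightarrow> 'a) set \<Rightarrow> bool" where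
  "subshift G A X \<longleftrightarrow>
     closedin (full_shift G A) X \<and> (\<forall>g \<in> carrier G. \<forall>x \<in> X. shift G g x \<in> X)"

(* The actions act and act' are explicit, so that products of subshifts, with their
   diagonal actions, can serve as source and target. *)
definition block_map ::
  "('g, 'b) monoid_scheme \<Rightarrow> 'x topology \<Rightarrow> ('g \<Rightarrow> 'x \<Rightarrow> 'x) \<Rightarrow>
     'y topology \<Rightarrow> ('g \<Rightarrow> 'y \<Rightarrow> 'y) \<Rightarrow> ('x \<Rightarrow> 'y) \<Rightarrow> bool" where
  "block_map G T act T' act' f \<longleftrightarrow>
     continuous_map T T' f \<and>
     (\<forall>g \<in> carrier G. \<forall>x \<in> topspace T. f (act g x) = act' g (f x))"

definition constant_config :: "('g, 'b) monoid_scheme \<Rightarrow> 'a \<Rightarrow> ('g \<Rightarrow> 'a)" where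
  "constant_config G a = (\<lambda>h \<in> carrier G. a)"

definition contractible_subshift ::
  "('g, 'b) monoid_scheme \<Rightarrow> 'a set \<Rightarrow> ('g \<Rightarrow> 'a) set \<Rightarrow> bool" where
  "contractible_subshift G A X \<longleftrightarrow>
     subshift G A X \<and>
     (\<exists>h. block_map G
            (prod_topology (full_shift G {0, 1 :: nat})
               (prod_topology (subtopology (full_shift G A) X) (subtopology (full_shift G A) X)))
            (\<lambda>g (t, x, y). (shift G g t, shift G g x, shift G g y))
            (subtopology (full_shift G A) X) (shift G) h \<and>
          (\<forall>x \<in> X. \<forall>y \<in> X. h (constant_config G 0, x, y) = x \<and>
                              h (constant_config G 1, x, y) = y))"

definition finite_index :: "('g, 'b) monoid_scheme \<Rightarrow> 'g set \<Rightarrow> bool" where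
  "finite_index G H \<longleftrightarrow> subgroup H G \<and> finite (rcosets\<^bsub>G\<^esub> H)"

definition periodic :: "('g, 'b) monoid_scheme \<Rightarrow> ('g \<Rightarrow> 'a) \<Rightarrow> bool" where
  "periodic G x \<longleftrightarrow> finite_index G (stabilizer G (shift G) x)"

definition residually_finite :: "('g, 'b) monoid_scheme \<Rightarrow> bool" where
  "residually_finite G \<longleftrightarrow>
     (\<forall>g \<in> carrier G. g \<noteq> \<one>\<^bsub>G\<^esub> \<longrightarrow> (\<exists>N. N \<lhd> G \<and> finite_index G N \<and> g \<notin> N))"

definition finite_symmetric_generators :: "('g, 'b) monoid_scheme \<Rightarrow> 'g set \<Rightarrow> bool" where
  "finite_symmetric_generators G S \<longleftrightarrow>
     finite S \<and> S \<subseteq> carrier G \<and> (\<forall>s \<in> S. inv\<^bsub>G\<^esub> s \<in> S) \<and> generate G S = carrier G"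

definition word_norm :: "('g, 'b) monoid_scheme \<Rightarrow> 'g set \<Rightarrow> 'g \<Rightarrow> nat" where
  "word_norm G S g =
     (LEAST n. \<exists>w. set w \<subseteq> S \<and> length w = n \<and> foldr (\<otimes>\<^bsub>G\<^esub>) w \<one>\<^bsub>G\<^esub> = g)"

definition color_edges ::
  "('g, 'b) monoid_scheme \<Rightarrow> 'g set \<Rightarrow> nat \<Rightarrow> ('g \<Rightarrow> nat) \<Rightarrow> nat \<Rightarrow> ('g \<times> 'g) set" where
  "color_edges G S r x c =
     {(a, b). a \<in> carrier G \<and> b \<in> carrier G \<and> x a = c \<and> x b = c \<and>
              word_norm G S (inv\<^bsub>G\<^esub> a \<otimes>\<^bsub>G\<^esub> b) \<le> r}"

(* For symmetric S the edge relation is symmetric, so the vertices reachable from a form the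
   connected component of a. Finiteness is explicit because card is 0 on infinite sets. *)
definition bounded_colorings ::
  "('g, 'b) monoid_scheme \<Rightarrow> 'g set \<Rightarrow> nat \<Rightarrow> nat \<Rightarrow> nat \<Rightarrow> ('g \<Rightarrow> nat) set" where
  "bounded_colorings G S n r m =
     {x \<in> topspace (full_shift G {1..n}).
        \<forall>c \<in> {1..n}. \<forall>a \<in> carrier G. x a = c \<longrightarrow>
          (let C = (color_edges G S r x c)\<^sup>* `` {a} in finite C \<and> card C \<le> m)}"

(* In enat the infimum of the empty set is infinity. *)
definition pdim :: "('g, 'b) monoid_scheme \<Rightarrow> 'g set \<Rightarrow> enat" where
  "pdim G S =
     Inf {enat d | d. \<forall>r. \<exists>m. \<exists>x \<in> bounded_colorings G S (d + 1) r m. periodic G x}"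

end

theory Submission
  imports Defs
begin

text \<open>
  By compactness the homotopy \<open>h\<close> has a finite radius \<open>R\<close>. Feeding it the indicator of a set
  \<open>U\<close> glues two points of \<open>X\<close>: the result equals the second point deep inside \<open>U\<close>, the first
  one far from \<open>U\<close>, and near the seam it is read off locally from both. Let \<open>w \<in> X\<close> be the point
  to be approximated. Take a periodic colouring with \<open>n = pdim + 1\<close> colours at a scale much larger
  than \<open>n R\<close>, and a finite-index subgroup \<open>H\<close> of its stabilizer which, by residual finiteness,
  moves every monochromatic component off itself. Translates of \<open>w\<close>, chosen
  \<open>H\<close>-equivariantly, can then be pasted near all components of one colour simultaneously. Starting
  from any point of \<open>X\<close> and doing this for one colour after the other, each step makes the point
  \<open>H\<close>-periodic around the current colour and costs a layer of thickness \<open>R\<close> around the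
  earlier ones; after \<open>n\<close> steps the point is \<open>H\<close>-periodic everywhere. A last paste, along \<open>H\<close>
  itself, makes it agree with \<open>w\<close> near the identity. All points stay in \<open>X\<close> throughout, so \<open>X\<close>
  need not be known to be of finite type.
\<close>

section \<open>Finite-index subgroups and equivariant labels\<close>

text \<open>A path from \<open>a\<close> stays in the component of \<open>a\<close>, which carries
  at most \<open>m * m\<close> edges, and a shortest path repeats none. This turns a bound on the
  cardinality of monochromatic components into a bound on their diameter.\<close>

lemma rtrancl_relpow_bound:
  assumes fin: "finite (E\<^sup>* `` {a})" and card: "card (E\<^sup>* `` {a}) \<le> m" and ab: "(a, b) \<in> E\<^sup>*"
  obtains n where "n \<le> m * m" "(a, b) \<in> E ^^ n"
proof -
  define C where "C = E\<^sup>* `` {a}"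
  define F where "F = E \<inter> C \<times> C"
  have F_E: "F ^^ k \<subseteq> E ^^ k" for k
    by (induction k) (auto simp: F_def)
  have "(a, b) \<in> F\<^sup>*"
    using ab
  proof (induction rule: rtrancl_induct)
    case (step y z)
    then have "y \<in> C" "z \<in> C"
      unfolding C_def by auto
    with step show ?case
      by (auto simp: F_def intro: rtrancl.rtrancl_into_rtrancl)
  qed simp
  moreover have "finite F"
    using fin by (auto simp: F_def C_def)
  ultimately obtain n where n: "n \<le> card F" "(a, b) \<in> F ^^ n"
    using rtrancl_finite_eq_relpow by blast
  have "card F \<le> card (C \<times> C)"
    using fin by (intro card_mono) (auto simp: F_def C_def)
  also have "\<dots> \<le> m * m"
    using card by (simp add: card_cartesian_product C_def mult_le_mono)
  finally have "n \<le> m * m"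
    using n by linarith
  moreover have "(a, b) \<in> E ^^ n"
    using n F_E by blast
  ultimately show thesis
    using that by blast
qed

context group
begin

lemma inv_mult_cancel_left [simp]:
  assumes "a \<in> carrier G" "b \<in> carrier G"
  shows "inv a \<otimes> (a \<otimes> b) = b" "a \<otimes> (inv a \<otimes> b) = b"
  using assms by (simp_all flip: m_assoc)

text \<open>Each coset of the intersection is a coset of \<open>H\<close> intersected with a coset
  of \<open>K\<close>, and there are finitely many such pairs.\<close>

lemma rcosets_Int_finite:
  assumes "subgroup H G" "subgroup K G" "finite (rcosets H)" "finite (rcosets K)"
  shows "finite (rcosets (H \<inter> K))"
proof (rule finite_subset)
  show "rcosets (H \<inter> K) \<subseteq> (\<lambda>(A, B). A \<inter> B) ` ((rcosets H) \<times> (rcosets K))"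
  proof
    fix C assume "C \<in> rcosets (H \<inter> K)"
    then obtain g where g: "g \<in> carrier G" "C = (H \<inter> K) #> g"
      unfolding RCOSETS_def by auto
    have "C = (H #> g) \<inter> (K #> g)"
    proof
      show "(H #> g) \<inter> (K #> g) \<subseteq> C"
      proof
        fix x assume "x \<in> (H #> g) \<inter> (K #> g)"
        then obtain h k where "h \<in> H" "k \<in> K" "x = h \<otimes> g" "x = k \<otimes> g"
          unfolding r_coset_def by auto
        moreover from this have "h = k"
          using g assms(1,2) by (metis right_cancel subgroup.mem_carrier)
        ultimately show "x \<in> C"
          using g unfolding r_coset_def by auto
      qed
    qed (auto simp: g r_coset_def)
    moreover have "H #> g \<in> rcosets H" "K #> g \<in> rcosets K"
      using g unfolding RCOSETS_def by auto
    ultimately show "C \<in> (\<lambda>(A, B). A \<inter> B) ` ((rcosets H) \<times> (rcosets K))"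
      by auto
  qed
  show "finite ((\<lambda>(A, B). A \<inter> B) ` ((rcosets H) \<times> (rcosets K)))"
    using assms by simp
qed

lemma finite_index_Int: "finite_index G H \<Longrightarrow> finite_index G K \<Longrightarrow> finite_index G (H \<inter> K)"
  by (simp add: finite_index_def rcosets_Int_finite subgroups_Inter_pair)

text \<open>Since \<open>K <#> H = K\<close>, multiplication by \<open>K\<close> sends the cosets of
  \<open>H\<close> onto those of \<open>K\<close>.\<close>

lemma finite_index_supergroup:
  assumes "finite_index G H" "subgroup K G" "H \<subseteq> K"
  shows "finite_index G K"
proof -
  have H: "subgroup H G" "finite (rcosets H)"
    using assms by (auto simp: finite_index_def)
  have "rcosets K \<subseteq> (\<lambda>C. K <#> C) ` (rcosets H)"
  proof
    fix C assume "C \<in> rcosets K"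
    then obtain g where g: "g \<in> carrier G" "C = K #> g"
      unfolding RCOSETS_def by auto
    have "K <#> (H #> g) = K <#> H #> g"
      using g H assms(2) by (intro setmult_rcos_assoc) (auto dest: subgroup.subset)
    also have "K <#> H = K"
    proof
      show "K <#> H \<subseteq> K"
        using assms by (auto simp: set_mult_def intro: subgroup.m_closed)
      show "K \<subseteq> K <#> H"
      proof
        fix x assume "x \<in> K"
        then have "x = x \<otimes> \<one>" "\<one> \<in> H"
          using H assms(2) by (auto simp: subgroup.one_closed subgroup.mem_carrier)
        with \<open>x \<in> K\<close> show "x \<in> K <#> H"
          unfolding set_mult_def by blast
      qed
    qed
    finally have "C = K <#> (H #> g)"
      using g by simp
    moreover have "H #> g \<in> rcosets H"
      using g unfolding RCOSETS_def by auto
    ultimately show "C \<in> (\<lambda>C. K <#> C) ` (rcosets H)"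
      by blast
  qed
  then show ?thesis
    using H assms(2) by (auto simp: finite_index_def intro: finite_subset)
qed

lemma finite_index_carrier: "finite_index G (carrier G)"
proof -
  have "rcosets (carrier G) = {carrier G}"
    unfolding RCOSETS_def using coset_join2[OF _ subgroup_self] by auto
  then show ?thesis
    by (simp add: finite_index_def subgroup_self)
qed

text \<open>One normal subgroup per element of \<open>F\<close> is intersected. Normality is kept
  because later it is conjugates of elements that have to avoid a ball.\<close>

lemma residually_finite_avoid:
  assumes "residually_finite G" "finite F" "F \<subseteq> carrier G" "\<one> \<notin> F"
  shows "\<exists>N. N \<lhd> G \<and> finite_index G N \<and> N \<inter> F = {}"
  using assms(2-4)
proof (induction F rule: finite_induct)
  case empty
  have "carrier G \<lhd> G"
    by (simp add: normal_inv_iff subgroup_self)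
  then show ?case
    using finite_index_carrier by blast
next
  case (insert g F)
  then obtain N where N: "N \<lhd> G" "finite_index G N" "N \<inter> F = {}"
    by auto
  obtain M where M: "M \<lhd> G" "finite_index G M" "g \<notin> M"
    using insert.prems assms(1) unfolding residually_finite_def by (metis insert_iff subset_iff)
  have "N \<inter> M \<lhd> G"
    using N(1) M(1) by (rule normal_subgroup_intersect)
  moreover have "finite_index G (N \<inter> M)"
    using N M by (blast intro: finite_index_Int)
  ultimately show ?case
    using N M by blast
qed

section \<open>The shift action and its stabilizers\<close>

lemma shift_apply: "h \<in> carrier G \<Longrightarrow> shift G g x h = x (inv g \<otimes> h)"
  by (simp add: shift_def)

lemma shift_one: "x \<in> extensional (carrier G) \<Longrightarrow> shift G \<one> x = x"
  by (auto simp: shift_def fun_eq_iff extensional_def)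

lemma shift_shift:
  "g \<in> carrier G \<Longrightarrow> h \<in> carrier G \<Longrightarrow> shift G g (shift G h x) = shift G (g \<otimes> h) x"
  by (auto simp: shift_def fun_eq_iff inv_mult_group m_assoc)

lemma subgroup_stabilizer_shift:
  assumes "x \<in> extensional (carrier G)"
  shows "subgroup (stabilizer G (shift G) x) G"
proof
  fix g h assume gh: "g \<in> stabilizer G (shift G) x" "h \<in> stabilizer G (shift G) x"
  then show "g \<otimes> h \<in> stabilizer G (shift G) x"
    using shift_shift[of g h x] by (auto simp: stabilizer_def)
  show "inv g \<in> stabilizer G (shift G) x"
    using gh shift_shift[of "inv g" g x] assms by (auto simp: stabilizer_def shift_one)
qed (auto simp: stabilizer_def assms shift_one)

lemma periodicI:
  assumes "finite_index G H" "x \<in> extensional (carrier G)"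
    and inv: "\<And>h g. h \<in> H \<Longrightarrow> g \<in> carrier G \<Longrightarrow> x (h \<otimes> g) = x g"
  shows "periodic G x"
proof -
  have H: "subgroup H G"
    using assms(1) by (simp add: finite_index_def)
  have "H \<subseteq> stabilizer G (shift G) x"
  proof
    fix h assume "h \<in> H"
    then have "shift G h x = x"
      using assms(2) inv[OF subgroup.m_inv_closed[OF H]]
      by (auto simp: shift_def fun_eq_iff extensional_def)
    then show "h \<in> stabilizer G (shift G) x"
      using \<open>h \<in> H\<close> H by (auto simp: stabilizer_def subgroup.mem_carrier)
  qed
  then show ?thesis
    unfolding periodic_def
    using assms subgroup_stabilizer_shift by (blast intro: finite_index_supergroup)
qed

lemma stabilizer_shiftD:
  assumes "h \<in> stabilizer G (shift G) x" "g \<in> carrier G"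
  shows "x (h \<otimes> g) = x g"
proof -
  have h: "h \<in> carrier G" "shift G h x = x"
    using assms by (auto simp: stabilizer_def)
  have "x (h \<otimes> g) = shift G h x (h \<otimes> g)"
    by (simp add: h)
  also have "\<dots> = x g"
    using h(1) assms(2) by (simp add: shift_apply)
  finally show ?thesis .
qed

text \<open>Freeness of the action on equivalence classes makes a label, once fixed on one
  representative of each orbit, extend unambiguously along the orbit.\<close>

lemma equivariant_label:
  assumes H: "subgroup H G"
    and V: "V \<subseteq> carrier G" "\<And>h a. h \<in> H \<Longrightarrow> a \<in> V \<Longrightarrow> h \<otimes> a \<in> V"
    and R: "equiv V R"
    and inv: "\<And>h a b. h \<in> H \<Longrightarrow> (a, b) \<in> R \<Longrightarrow> (h \<otimes> a, h \<otimes> b) \<in> R"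
    and free: "\<And>h a. h \<in> H \<Longrightarrow> (a, h \<otimes> a) \<in> R \<Longrightarrow> h = \<one>"
  obtains k where "\<And>a. a \<in> V \<Longrightarrow> k a \<in> H"
    and "\<And>h a. h \<in> H \<Longrightarrow> a \<in> V \<Longrightarrow> k (h \<otimes> a) = h \<otimes> k a"
    and "\<And>a b. (a, b) \<in> R \<Longrightarrow> k a = k b"
proof -
  note Hc = subgroup.mem_carrier[OF H]
  have RV: "a \<in> V" "b \<in> V" if "(a, b) \<in> R" for a b
    using that R by (auto simp: equiv_def refl_on_def)
  have refl: "(a, a) \<in> R" if "a \<in> V" for a
    using that R by (auto simp: equiv_def refl_on_def)
  have sym: "(b, a) \<in> R" if "(a, b) \<in> R" for a b
    using that R by (auto simp: equiv_def sym_def)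
  have trans: "(a, c) \<in> R" if "(a, b) \<in> R" "(b, c) \<in> R" for a b c
    using that R by (meson equiv_def transD)
  \<comment> \<open>\<open>T\<close> merges the \<open>R\<close>-classes that lie in one
    \<open>H\<close>-orbit; \<open>s\<close> below picks a base point in each merged class.\<close>
  define T where "T = {(a, b). a \<in> V \<and> b \<in> V \<and> (\<exists>h\<in>H. (h \<otimes> a, b) \<in> R)}"
  have T: "equiv V T"
  proof (rule equivI)
    show "T \<subseteq> V \<times> V"
      by (auto simp: T_def)
    show "refl_on V T"
      using refl subgroup.one_closed[OF H] V(1)
      by (auto simp: T_def refl_on_def subset_iff intro!: bexI[of _ \<one>])
    show "sym T"
    proof (rule symI)
      fix a b assume "(a, b) \<in> T"
      then obtain h where h: "a \<in> V" "b \<in> V" "h \<in> H" "(h \<otimes> a, b) \<in> R"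
        by (auto simp: T_def)
      have "(inv h \<otimes> (h \<otimes> a), inv h \<otimes> b) \<in> R"
        using h by (intro inv subgroup.m_inv_closed[OF H])
      then have "(inv h \<otimes> b, a) \<in> R"
        using h V(1) Hc by (auto simp: subset_iff sym)
      then show "(b, a) \<in> T"
        using h subgroup.m_inv_closed[OF H] by (auto simp: T_def)
    qed
    show "trans T"
    proof (rule transI)
      fix a b c assume "(a, b) \<in> T" "(b, c) \<in> T"
      then obtain h k where h: "a \<in> V" "b \<in> V" "c \<in> V" "h \<in> H" "k \<in> H"
        "(h \<otimes> a, b) \<in> R" "(k \<otimes> b, c) \<in> R"
        by (auto simp: T_def)
      have "(k \<otimes> (h \<otimes> a), c) \<in> R"
        using h inv trans by blast
      then have "((k \<otimes> h) \<otimes> a, c) \<in> R"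
        using h V(1) Hc by (simp add: m_assoc subset_iff)
      then show "(a, c) \<in> T"
        using h subgroup.m_closed[OF H] by (auto simp: T_def)
    qed
  qed
  define s where "s a = (SOME x. x \<in> T `` {a})" for a
  have sT: "(a, s a) \<in> T" if "a \<in> V" for a
  proof -
    have "\<exists>x. x \<in> T `` {a}"
      using that T by (auto simp: equiv_def refl_on_def)
    then show ?thesis
      unfolding s_def by (metis Image_singleton_iff someI_ex)
  qed
  have s_eq: "s a = s b" if "(a, b) \<in> T" for a b
    using equiv_class_eq[OF T that] by (simp add: s_def)
  have uniq: "h = h'" if "h \<in> H" "h' \<in> H" "x \<in> V" "(h \<otimes> x, a) \<in> R" "(h' \<otimes> x, a) \<in> R" for h h' x a
  proof -
    have "(inv h \<otimes> (h \<otimes> x), inv h \<otimes> (h' \<otimes> x)) \<in> R"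
      using that by (intro inv subgroup.m_inv_closed[OF H]) (blast intro: trans sym)+
    then have "(x, (inv h \<otimes> h') \<otimes> x) \<in> R"
      using that V(1) Hc by (simp add: subset_iff m_assoc)
    then have "inv h \<otimes> h' = \<one>"
      using free that subgroup.m_closed[OF H] subgroup.m_inv_closed[OF H] by blast
    then show ?thesis
      using that Hc by (metis inv_equality inv_closed inv_inv)
  qed
  \<comment> \<open>The label is the unique element of \<open>H\<close> carrying the class of the
    base point to the class of \<open>a\<close>; uniqueness is freeness. As \<open>s\<close> is
    constant along orbits, equivariance follows from uniqueness.\<close>
  define k where "k a = (THE h. h \<in> H \<and> (h \<otimes> s a, a) \<in> R)" for a
  have kI: "k a = h" if "a \<in> V" "h \<in> H" "(h \<otimes> s a, a) \<in> R" for a h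
    unfolding k_def using that uniq sT[OF that(1)] by (intro the_equality) (auto simp: T_def)
  have k: "k a \<in> H" "(k a \<otimes> s a, a) \<in> R" if "a \<in> V" for a
  proof -
    have "(s a, a) \<in> T"
      using sT[OF that] T by (auto simp: equiv_def sym_def)
    then obtain h where "h \<in> H" "(h \<otimes> s a, a) \<in> R"
      by (auto simp: T_def)
    with kI[OF that] show "k a \<in> H" "(k a \<otimes> s a, a) \<in> R"
      by auto
  qed
  show thesis
  proof (rule that)
    show "k a \<in> H" if "a \<in> V" for a
      using k that by blast
    show "k (h \<otimes> a) = h \<otimes> k a" if "h \<in> H" "a \<in> V" for h a
    proof (rule kI)
      have "(a, h \<otimes> a) \<in> T"
        using that V refl unfolding T_def by blast
      then have "s (h \<otimes> a) = s a"
        using s_eq by simp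
      moreover have "(h \<otimes> (k a \<otimes> s a), h \<otimes> a) \<in> R"
        using that k inv by blast
      moreover have "s a \<in> carrier G"
        using sT that V by (auto simp: T_def)
      ultimately show "((h \<otimes> k a) \<otimes> s (h \<otimes> a), h \<otimes> a) \<in> R"
        using that k Hc by (simp add: m_assoc)
      show "h \<otimes> k a \<in> H"
        using that k subgroup.m_closed[OF H] by blast
    qed (use that V in auto)
    show "k a = k b" if "(a, b) \<in> R" for a b
    proof (rule kI)
      have ab: "a \<in> V" "b \<in> V"
        using that RV by auto
      have "(a, b) \<in> T"
        using ab that V(1) subgroup.one_closed[OF H]
        by (auto simp: T_def subset_iff intro!: bexI[of _ \<one>])
      then have "s a = s b"
        by (rule s_eq)
      then show "(k b \<otimes> s a, a) \<in> R"
        using k[OF ab(2)] that by (metis trans sym)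
      show "k b \<in> H" "a \<in> V"
        using k ab by auto
    qed
  qed
qed

end

section \<open>Balls of the word metric\<close>

locale word_metric = group +
  fixes S
  assumes gens: "finite_symmetric_generators G S"
begin

abbreviation word_value :: "'a list \<Rightarrow> 'a" where
  "word_value w \<equiv> foldr (\<otimes>) w \<one>"

text \<open>The carrier is mentioned because the \<open>LEAST\<close> in \<open>word_norm\<close> is
  unspecified where no word exists. The distance from \<open>a\<close> to \<open>b\<close> is the
  norm of \<open>inv a \<otimes> b\<close>, invariant under left translation, the side on which
  subgroups act here.\<close>

definition wball :: "nat \<Rightarrow> 'a set" where
  "wball n = {g \<in> carrier G. word_norm G S g \<le> n}"

lemma gens_carrier: "S \<subseteq> carrier G"
  using gens by (simp add: finite_symmetric_generators_def)

lemma word_value_closed: "set w \<subseteq> S \<Longrightarrow> word_value w \<in> carrier G"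
  using gens_carrier by (induction w) auto

lemma word_value_append:
  "set v \<subseteq> S \<Longrightarrow> set w \<subseteq> S \<Longrightarrow> word_value (v @ w) = word_value v \<otimes> word_value w"
  using gens_carrier by (induction v) (auto simp: word_value_closed m_assoc)

lemma word_value_inverse:
  "set w \<subseteq> S \<Longrightarrow> \<exists>v. set v \<subseteq> S \<and> length v = length w \<and> word_value v = inv (word_value w)"
proof (induction w)
  case (Cons s w)
  then obtain v where v: "set v \<subseteq> S" "length v = length w" "word_value v = inv (word_value w)"
    by auto
  have s: "s \<in> S" "s \<in> carrier G" "inv s \<in> S"
    using Cons.prems gens by (auto simp: finite_symmetric_generators_def)
  have "word_value (v @ [inv s]) = inv (word_value (s # w))"
    using v s Cons.prems word_value_append[of v "[inv s]"] 
    by (auto simp: word_value_closed inv_mult_group simp del: foldr_append)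
  with v s show ?case
    by (intro exI[of _ "v @ [inv s]"]) auto
qed simp

lemma word_exists: "g \<in> carrier G \<Longrightarrow> \<exists>w. set w \<subseteq> S \<and> word_value w = g"
proof -
  assume "g \<in> carrier G"
  then have "g \<in> generate G S"
    using gens by (simp add: finite_symmetric_generators_def)
  then show ?thesis
  proof induction
    case (incl h)
    then show ?case
      using gens_carrier by (intro exI[of _ "[h]"]) auto
  next
    case (inv h)
    then have "inv h \<in> S" "inv h \<in> carrier G"
      using gens gens_carrier by (auto simp: finite_symmetric_generators_def)
    then show ?case
      by (intro exI[of _ "[inv h]"]) auto
  next
    case (eng g h)
    then obtain v w where "set v \<subseteq> S" "word_value v = g" "set w \<subseteq> S" "word_value w = h"
      by blast
    then show ?case
      using word_value_append[of v w] by (intro exI[of _ "v @ w"]) auto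
  qed (auto intro: exI[of _ "[]"])
qed

text \<open>As \<open>S\<close> generates, the least word length is attained. Closure of balls under
  products and inverses, and their finiteness, thereby become facts about words.\<close>

lemma wball_iff: "g \<in> wball n \<longleftrightarrow> (\<exists>w. set w \<subseteq> S \<and> length w \<le> n \<and> word_value w = g)"
proof
  assume "g \<in> wball n"
  then have g: "g \<in> carrier G" "word_norm G S g \<le> n"
    by (auto simp: wball_def)
  have "\<exists>w. set w \<subseteq> S \<and> length w = word_norm G S g \<and> word_value w = g"
    unfolding word_norm_def by (rule LeastI_ex) (use word_exists[OF g(1)] in blast)
  with g show "\<exists>w. set w \<subseteq> S \<and> length w \<le> n \<and> word_value w = g"
    by metis
next
  assume "\<exists>w. set w \<subseteq> S \<and> length w \<le> n \<and> word_value w = g"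
  then obtain w where w: "set w \<subseteq> S" "length w \<le> n" "word_value w = g"
    by blast
  then have "word_norm G S g \<le> length w"
    unfolding word_norm_def by (intro Least_le) blast
  then show "g \<in> wball n"
    using w word_value_closed by (auto simp: wball_def)
qed

lemma wball_carrier: "wball n \<subseteq> carrier G"
  by (auto simp: wball_def)

lemma wball_closed [simp]: "b \<in> wball n \<Longrightarrow> b \<in> carrier G"
  by (auto simp: wball_def)

lemma wball_mono: "m \<le> n \<Longrightarrow> wball m \<subseteq> wball n"
  by (auto simp: wball_def simp del: wball_closed)

lemma one_wball [simp]: "\<one> \<in> wball n"
  unfolding wball_iff by (auto intro: exI[of _ "[]"])

lemma inv_wball [simp]: "b \<in> wball n \<Longrightarrow> inv b \<in> wball n"
  unfolding wball_iff using word_value_inverse by metis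

lemma mult_wball: "a \<in> wball m \<Longrightarrow> b \<in> wball n \<Longrightarrow> a \<otimes> b \<in> wball (m + n)"
proof -
  assume "a \<in> wball m" "b \<in> wball n"
  then obtain v w where "set v \<subseteq> S" "length v \<le> m" "word_value v = a"
    "set w \<subseteq> S" "length w \<le> n" "word_value w = b"
    unfolding wball_iff by blast
  then show ?thesis
    unfolding wball_iff using word_value_append[of v w] by (intro exI[of _ "v @ w"]) auto
qed

lemma finite_wball: "finite (wball n)"
proof -
  have "finite (word_value ` {w. set w \<subseteq> S \<and> length w \<le> n})"
    using gens finite_lists_length_le[of S n] by (simp add: finite_symmetric_generators_def)
  moreover have "wball n \<subseteq> word_value ` {w. set w \<subseteq> S \<and> length w \<le> n}"
    by (auto simp: wball_iff)
  ultimately show ?thesis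
    by (rule finite_subset[rotated])
qed

lemma finite_subset_wball:
  assumes "finite F" "F \<subseteq> carrier G"
  obtains n where "F \<subseteq> wball n"
proof
  show "F \<subseteq> wball (Max (insert 0 (word_norm G S ` F)))"
    using assms by (auto simp: wball_def simp del: wball_closed)
qed

lemma dist_triangle:
  assumes "a \<in> carrier G" "b \<in> carrier G" "c \<in> carrier G"
    and "inv a \<otimes> b \<in> wball m" "inv b \<otimes> c \<in> wball n"
  shows "inv a \<otimes> c \<in> wball (m + n)"
proof -
  have "inv a \<otimes> c = (inv a \<otimes> b) \<otimes> (inv b \<otimes> c)"
    using assms by (simp add: m_assoc)
  then show ?thesis
    using mult_wball assms by simp
qed

lemma dist_sym:
  assumes "a \<in> carrier G" "b \<in> carrier G" "inv a \<otimes> b \<in> wball n"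
  shows "inv b \<otimes> a \<in> wball n"
  using inv_wball[OF assms(3)] assms(1,2) by (simp add: inv_mult_group)

lemma dist_translate:
  assumes "h \<in> carrier G" "a \<in> carrier G" "b \<in> carrier G"
  shows "inv (h \<otimes> a) \<otimes> (h \<otimes> b) = inv a \<otimes> b"
  using assms by (simp add: inv_mult_group m_assoc)

end

section \<open>Compactness and gluing\<close>

lemma compact_space_full_shift: "finite A \<Longrightarrow> compact_space (full_shift G A)"
  by (simp add: full_shift_def compact_space_product_topology compact_space_discrete_topology)

lemma topspace_full_shift: "topspace (full_shift G A) = (carrier G \<rightarrow>\<^sub>E A)"
  by (simp add: full_shift_def)

lemma subshift_subset: "subshift G A X \<Longrightarrow> X \<subseteq> (carrier G \<rightarrow>\<^sub>E A)"
  by (metis closedin_subset subshift_def topspace_full_shift)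

lemma continuous_map_full_shift_eval:
  "g \<in> carrier G \<Longrightarrow> continuous_map (full_shift G A) (discrete_topology A) (\<lambda>x. x g)"
  unfolding full_shift_def by (rule continuous_map_product_projection)

text \<open>Each condition on one coordinate cuts out a closed cylinder, so the finite intersection
  property in the compact set \<open>X\<close> applies. It will allow infinitely many patches to be
  prescribed at once.\<close>

lemma subshift_compactness:
  assumes "subshift G A X" "finite A" "D \<subseteq> carrier G"
    and fin: "\<And>F. finite F \<Longrightarrow> F \<subseteq> D \<Longrightarrow> \<exists>Z\<in>X. \<forall>g\<in>F. Z g = p g"
  shows "\<exists>Z\<in>X. \<forall>g\<in>D. Z g = p g"
proof -
  \<comment> \<open>\<open>p g\<close> might lie outside \<open>A\<close>; intersecting with
    \<open>A\<close> makes the target a closed set of the discrete space.\<close>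
  define C where "C g = {Z \<in> topspace (full_shift G A). Z g \<in> A \<inter> {p g}}" for g
  have "compactin (full_shift G A) X"
    using assms(1,2) by (auto simp: subshift_def intro: closedin_compact_space compact_space_full_shift)
  moreover have "closedin (full_shift G A) K" if "K \<in> C ` D" for K
  proof -
    obtain g where "g \<in> carrier G" "K = C g"
      using \<open>K \<in> C ` D\<close> assms(3) by blast
    then show ?thesis
      unfolding \<open>K = C g\<close> C_def
      by (intro closedin_continuous_map_preimage[OF continuous_map_full_shift_eval]) auto
  qed
  moreover have "X \<inter> \<Inter>\<F> \<noteq> {}" if "finite \<F>" "\<F> \<subseteq> C ` D" for \<F>
  proof -
    obtain F where F: "finite F" "F \<subseteq> D" "\<F> = C ` F"
      using finite_subset_image[OF \<open>finite \<F>\<close> \<open>\<F> \<subseteq> C ` D\<close>] by blast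
    obtain Z where Z: "Z \<in> X" "\<forall>g\<in>F. Z g = p g"
      using fin F by blast
    have "Z g \<in> A" if "g \<in> F" for g
      using Z(1) subshift_subset[OF assms(1)] that F assms(3) by auto
    moreover have "Z \<in> topspace (full_shift G A)"
      using Z(1) subshift_subset[OF assms(1)] by (auto simp: topspace_full_shift)
    ultimately have "Z \<in> X \<inter> \<Inter>\<F>"
      using Z F by (auto simp: C_def)
    then show ?thesis
      by blast
  qed
  ultimately have "X \<inter> \<Inter>(C ` D) \<noteq> {}"
    by (simp add: compactin_fip)
  then show ?thesis
    by (auto simp: C_def)
qed

text \<open>A basic open box constrains only finitely many coordinates, and these form
  \<open>F\<close>. Agreement on \<open>F\<close> with any point of \<open>V\<close>, not only with
  \<open>x\<close>, suffices; this makes one radius valid on a whole member of a cover.\<close>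

lemma openin_full_shift_cylinder:
  assumes "openin (full_shift G A) U" "x \<in> U"
  obtains F V where "finite F" "F \<subseteq> carrier G" "openin (full_shift G A) V" "x \<in> V" "V \<subseteq> U"
    and "\<And>y z. y \<in> V \<Longrightarrow> z \<in> topspace (full_shift G A) \<Longrightarrow> (\<And>g. g \<in> F \<Longrightarrow> y g = z g) \<Longrightarrow> z \<in> V"
proof -
  obtain W where W: "finite {g \<in> carrier G. W g \<noteq> A}" "\<And>g. g \<in> carrier G \<Longrightarrow> W g \<subseteq> A"
    "x \<in> Pi\<^sub>E (carrier G) W" "Pi\<^sub>E (carrier G) W \<subseteq> U"
    using assms unfolding full_shift_def openin_product_topology_alt by fastforce
  show thesis
  proof (rule that)
    show "openin (full_shift G A) (Pi\<^sub>E (carrier G) W)"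
      unfolding full_shift_def openin_PiE_gen using W by simp
    show "z \<in> Pi\<^sub>E (carrier G) W" if "y \<in> Pi\<^sub>E (carrier G) W" "z \<in> topspace (full_shift G A)"
      "\<And>g. g \<in> {g \<in> carrier G. W g \<noteq> A} \<Longrightarrow> y g = z g" for y z
    proof -
      have "z g \<in> W g" if "g \<in> carrier G" for g
        using \<open>y \<in> Pi\<^sub>E (carrier G) W\<close> \<open>z \<in> topspace (full_shift G A)\<close> that
          \<open>\<And>g. g \<in> {g \<in> carrier G. W g \<noteq> A} \<Longrightarrow> y g = z g\<close>[of g]
        by (cases "W g = A") (auto simp: topspace_full_shift PiE_iff)
      then show ?thesis
        using \<open>z \<in> topspace (full_shift G A)\<close> by (simp add: topspace_full_shift PiE_iff)
    qed
  qed (use W(1,3,4) in simp_all)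
qed

context word_metric
begin

text \<open>The Curtis--Hedlund--Lyndon theorem, for maps on a triple product.\<close>

lemma continuous_map_local:
  assumes "finite A" "finite B" "subshift G B X"
    and cont: "continuous_map (prod_topology (full_shift G A)
        (prod_topology (subtopology (full_shift G B) X) (subtopology (full_shift G B) X)))
        (discrete_topology C) f"
  obtains R where "\<And>t t' x x' y y'. t \<in> carrier G \<rightarrow>\<^sub>E A \<Longrightarrow> t' \<in> carrier G \<rightarrow>\<^sub>E A \<Longrightarrow>
    x \<in> X \<Longrightarrow> x' \<in> X \<Longrightarrow> y \<in> X \<Longrightarrow> y' \<in> X \<Longrightarrow>
    (\<And>b. b \<in> wball R \<Longrightarrow> t b = t' b \<and> x b = x' b \<and> y b = y' b) \<Longrightarrow> f (t, x, y) = f (t', x', y')"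
proof -
  let ?X = "subtopology (full_shift G B) X"
  let ?P = "prod_topology (full_shift G A) (prod_topology ?X ?X)"
  have XT: "X \<subseteq> topspace (full_shift G B)"
    using subshift_subset[OF assms(3)] by (simp add: topspace_full_shift)
  have topP: "topspace ?P = (carrier G \<rightarrow>\<^sub>E A) \<times> X \<times> X"
    using XT by (auto simp: topspace_full_shift)
  have "compactin (full_shift G B) X"
    using assms by (auto simp: subshift_def intro: closedin_compact_space compact_space_full_shift)
  then have cP: "compact_space ?P"
    using assms by (simp add: compact_space_prod_topology compact_space_full_shift compact_space_subtopology)
  define agree where "agree R p q \<longleftrightarrow> (\<forall>b\<in>wball R. fst p b = fst q b
      \<and> fst (snd p) b = fst (snd q) b \<and> snd (snd p) b = snd (snd q) b)"
    for R and p q :: "('a \<Rightarrow> 'c) \<times> ('a \<Rightarrow> 'd) \<times> ('a \<Rightarrow> 'd)"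
  \<comment> \<open>One radius serves all points of a \<open>good\<close> set, so the maximal radius
    of a finite subcover serves everywhere.\<close>
  define good where "good R W \<longleftrightarrow> openin ?P W \<and> (\<forall>p\<in>W. \<forall>q\<in>topspace ?P. agree R p q \<longrightarrow> q \<in> W \<and> f p = f q)"
    for R W
  have good_mono: "good n W" if "good m W" "m \<le> n" for m n W
    using that wball_mono unfolding good_def agree_def by blast
  have "\<exists>R W. good R W \<and> p \<in> W" if "p \<in> topspace ?P" for p
  proof -
    obtain t x y where p: "p = (t, x, y)"
      by (cases p)
    \<comment> \<open>The target is discrete, so the fibre of \<open>f\<close> through
      \<open>p\<close> is open and contains a box of cylinders around \<open>p\<close>.\<close>
    define O1 where "O1 = {q \<in> topspace ?P. f q \<in> {f p}}"
    have "f p \<in> C"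
      using cont that by (auto simp: continuous_map_def)
    then have "openin ?P O1"
      unfolding O1_def by (intro openin_continuous_map_preimage[OF cont]) simp
    moreover have "(t, x, y) \<in> O1"
      using that p by (simp add: O1_def)
    ultimately obtain U1 Q1 where 1: "openin (full_shift G A) U1" "t \<in> U1"
      "openin (prod_topology ?X ?X) Q1" "(x, y) \<in> Q1" "U1 \<times> Q1 \<subseteq> O1"
      unfolding openin_prod_topology_alt[of _ "prod_topology ?X ?X"] by metis
    then obtain U2 U3 where 2: "openin ?X U2" "x \<in> U2" "openin ?X U3" "y \<in> U3" "U2 \<times> U3 \<subseteq> Q1"
      unfolding openin_prod_topology_alt[of ?X ?X] by metis
    then obtain U2' U3' where 3: "openin (full_shift G B) U2'" "U2 = U2' \<inter> X"
      "openin (full_shift G B) U3'" "U3 = U3' \<inter> X"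
      by (auto simp: openin_subtopology)
    obtain F1 V1 where V1: "finite F1" "F1 \<subseteq> carrier G" "openin (full_shift G A) V1" "t \<in> V1" "V1 \<subseteq> U1"
      "\<And>y z. y \<in> V1 \<Longrightarrow> z \<in> topspace (full_shift G A) \<Longrightarrow> (\<And>g. g \<in> F1 \<Longrightarrow> y g = z g) \<Longrightarrow> z \<in> V1"
      using openin_full_shift_cylinder[OF 1(1,2)] by metis
    have "x \<in> U2'" "y \<in> U3'"
      using 2 3 by auto
    obtain F2 V2 where V2: "finite F2" "F2 \<subseteq> carrier G" "openin (full_shift G B) V2" "x \<in> V2" "V2 \<subseteq> U2'"
      "\<And>y z. y \<in> V2 \<Longrightarrow> z \<in> topspace (full_shift G B) \<Longrightarrow> (\<And>g. g \<in> F2 \<Longrightarrow> y g = z g) \<Longrightarrow> z \<in> V2"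
      using openin_full_shift_cylinder[OF 3(1) \<open>x \<in> U2'\<close>] by metis
    obtain F3 V3 where V3: "finite F3" "F3 \<subseteq> carrier G" "openin (full_shift G B) V3" "y \<in> V3" "V3 \<subseteq> U3'"
      "\<And>y z. y \<in> V3 \<Longrightarrow> z \<in> topspace (full_shift G B) \<Longrightarrow> (\<And>g. g \<in> F3 \<Longrightarrow> y g = z g) \<Longrightarrow> z \<in> V3"
      using openin_full_shift_cylinder[OF 3(3) \<open>y \<in> U3'\<close>] by metis
    obtain R where R: "F1 \<union> F2 \<union> F3 \<subseteq> wball R"
      using finite_subset_wball[of "F1 \<union> F2 \<union> F3"] V1 V2 V3 by auto
    define W where "W = V1 \<times> (V2 \<inter> X) \<times> (V3 \<inter> X)"
    have WO: "W \<subseteq> O1"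
      unfolding W_def using V1(5) V2(5) V3(5) 1(5) 2(5) 3(2,4) by blast
    have "openin ?P W"
      unfolding W_def using V1 V2 V3 by (simp add: openin_prod_Times_iff openin_subtopology_Int)
    moreover have "q' \<in> W \<and> f q = f q'" if q: "q \<in> W" "q' \<in> topspace ?P" "agree R q q'" for q q'
    proof -
      obtain t1 x1 y1 t2 x2 y2 where eq: "q = (t1, x1, y1)" "q' = (t2, x2, y2)"
        by (cases q, cases q')
      have t: "t1 \<in> V1" "x1 \<in> V2" "y1 \<in> V3"
        and mem: "t2 \<in> topspace (full_shift G A)" "x2 \<in> X" "y2 \<in> X"
        using q(1,2) topP by (simp_all add: W_def eq topspace_full_shift)
      have eqs: "t1 g = t2 g" "x1 g = x2 g" "y1 g = y2 g" if "g \<in> F1 \<union> F2 \<union> F3" for g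
        using q(3) R that by (auto simp: agree_def eq)
      have "t2 \<in> V1"
        using V1(6)[OF t(1) mem(1)] eqs(1) by blast
      moreover have "x2 \<in> V2"
        using V2(6)[OF t(2)] mem(2) XT eqs(2) by blast
      moreover have "y2 \<in> V3"
        using V3(6)[OF t(3)] mem(3) XT eqs(3) by blast
      ultimately have "q' \<in> W"
        using mem by (simp add: W_def eq)
      moreover have "f q = f p" "f q' = f p"
        using q(1) \<open>q' \<in> W\<close> WO by (auto simp: O1_def)
      ultimately show ?thesis
        by simp
    qed
    ultimately have "good R W"
      unfolding good_def by blast
    moreover have "p \<in> W"
      using V1 V2 V3 2 3 by (auto simp: W_def p)
    ultimately show ?thesis
      by blast
  qed
  then have "topspace ?P \<subseteq> \<Union>{W. \<exists>R. good R W}"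
    by blast
  moreover have "openin ?P W" if "W \<in> {W. \<exists>R. good R W}" for W
    using that good_def by blast
  ultimately obtain \<F> where \<F>: "finite \<F>" "\<F> \<subseteq> {W. \<exists>R. good R W}" "topspace ?P \<subseteq> \<Union>\<F>"
    using cP[unfolded compact_space_alt, rule_format, of "{W. \<exists>R. good R W}"] by blast
  obtain r where r: "\<And>W. W \<in> \<F> \<Longrightarrow> good (r W) W"
  proof -
    have "\<forall>W\<in>\<F>. \<exists>n. good n W"
      using \<F>(2) by blast
    then obtain r where "\<forall>W\<in>\<F>. good (r W) W"
      by (rule bchoice[THEN exE])
    then show thesis
      using that by blast
  qed
  define R where "R = Max (insert 0 (r ` \<F>))"
  have goodR: "good R W" if "W \<in> \<F>" for W
    using r[OF that] by (rule good_mono) (use \<F>(1) that in \<open>simp add: R_def\<close>)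
  show thesis
  proof (rule that)
    fix t t' x x' y y'
    assume mem: "t \<in> carrier G \<rightarrow>\<^sub>E A" "t' \<in> carrier G \<rightarrow>\<^sub>E A" "x \<in> X" "x' \<in> X" "y \<in> X" "y' \<in> X"
      and eq: "\<And>b. b \<in> wball R \<Longrightarrow> t b = t' b \<and> x b = x' b \<and> y b = y' b"
    have "(t, x, y) \<in> topspace ?P" "(t', x', y') \<in> topspace ?P"
      using mem unfolding topP by auto
    moreover from this obtain W where "W \<in> \<F>" "(t, x, y) \<in> W"
      using \<F>(3) by blast
    moreover have "agree R (t, x, y) (t', x', y')"
      using eq by (simp add: agree_def)
    ultimately show "f (t, x, y) = f (t', x', y')"
      using goodR unfolding good_def by blast
  qed
qed

end

text \<open>\<open>glue U x y\<close> stands for the homotopy evaluated at the indicator of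
  \<open>U\<close>, at \<open>x\<close> and at \<open>y\<close>. \<open>glue_local\<close> combines
  finite radius with equivariance: the value is read off the three patterns in a ball by a rule that
  is the same at every point.\<close>

locale gluing = word_metric +
  fixes A :: "'c set" and X :: "('a \<Rightarrow> 'c) set"
    and glue :: "'a set \<Rightarrow> ('a \<Rightarrow> 'c) \<Rightarrow> ('a \<Rightarrow> 'c) \<Rightarrow> ('a \<Rightarrow> 'c)" and R :: nat
  assumes finite_alphabet: "finite A"
    and subshift: "subshift G A X"
    and glue_closed: "x \<in> X \<Longrightarrow> y \<in> X \<Longrightarrow> glue U x y \<in> X"
    and glue_inside: "x \<in> X \<Longrightarrow> y \<in> X \<Longrightarrow> g \<in> carrier G \<Longrightarrow>
      (\<And>b. b \<in> wball R \<Longrightarrow> g \<otimes> b \<in> U) \<Longrightarrow> glue U x y g = y g"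
    and glue_outside: "x \<in> X \<Longrightarrow> y \<in> X \<Longrightarrow> g \<in> carrier G \<Longrightarrow>
      (\<And>b. b \<in> wball R \<Longrightarrow> g \<otimes> b \<notin> U) \<Longrightarrow> glue U x y g = x g"
    and glue_local: "x \<in> X \<Longrightarrow> y \<in> X \<Longrightarrow> g \<in> carrier G \<Longrightarrow> g' \<in> carrier G \<Longrightarrow>
      (\<And>b. b \<in> wball R \<Longrightarrow> (g \<otimes> b \<in> U \<longleftrightarrow> g' \<otimes> b \<in> U) \<and>
        x (g \<otimes> b) = x (g' \<otimes> b) \<and> y (g \<otimes> b) = y (g' \<otimes> b)) \<Longrightarrow>
      glue U x y g = glue U x y g'"

text \<open>Continuity makes the identity coordinate of \<open>h\<close> local, and equivariance
  carries the same rule to every \<open>g\<close>. On an \<open>R\<close>-ball inside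
  \<open>U\<close> the indicator looks like the constant 1, on one outside like the constant 0, and
  there \<open>h\<close> is a projection.\<close>

lemma (in word_metric) contractible_gluing:
  assumes "finite A" "contractible_subshift G A X"
  obtains glue R where "gluing G S A X glue R"
proof -
  let ?X = "subtopology (full_shift G A) X"
  let ?P = "prod_topology (full_shift G {0, 1 :: nat}) (prod_topology ?X ?X)"
  obtain h where sub: "subshift G A X"
    and block: "block_map G ?P (\<lambda>g (t, x, y). (shift G g t, shift G g x, shift G g y)) ?X (shift G) h"
    and ends: "\<And>x y. x \<in> X \<Longrightarrow> y \<in> X \<Longrightarrow> h (constant_config G 0, x, y) = x"
      "\<And>x y. x \<in> X \<Longrightarrow> y \<in> X \<Longrightarrow> h (constant_config G 1, x, y) = y"
    using assms(2) unfolding contractible_subshift_def by blast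
  have XT: "X \<subseteq> topspace (full_shift G A)"
    using subshift_subset[OF sub] by (simp add: topspace_full_shift)
  have topP: "topspace ?P = (carrier G \<rightarrow>\<^sub>E {0, 1}) \<times> X \<times> X"
    using XT by (auto simp: topspace_full_shift)
  have cont: "continuous_map ?P ?X h"
    using block by (simp add: block_map_def)
  have hX: "h (t, x, y) \<in> X" if "t \<in> carrier G \<rightarrow>\<^sub>E {0, 1}" "x \<in> X" "y \<in> X" for t x y
  proof -
    have "(t, x, y) \<in> topspace ?P"
      using that topP by simp
    then show ?thesis
      using cont by (auto simp: continuous_map_def)
  qed
  have "continuous_map ?P (full_shift G A) h"
    using cont by (simp add: continuous_map_in_subtopology)
  then have "continuous_map ?P (discrete_topology A) (\<lambda>p. h p \<one>)"
    using continuous_map_compose[OF _ continuous_map_full_shift_eval, of ?P G A h \<one>] by (simp add: o_def)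
  then obtain R where R: "\<And>t t' x x' y y'. t \<in> carrier G \<rightarrow>\<^sub>E {0, 1} \<Longrightarrow> t' \<in> carrier G \<rightarrow>\<^sub>E {0, 1} \<Longrightarrow>
    x \<in> X \<Longrightarrow> x' \<in> X \<Longrightarrow> y \<in> X \<Longrightarrow> y' \<in> X \<Longrightarrow>
    (\<And>b. b \<in> wball R \<Longrightarrow> t b = t' b \<and> x b = x' b \<and> y b = y' b) \<Longrightarrow> h (t, x, y) \<one> = h (t', x', y') \<one>"
    using continuous_map_local[of "{0, 1 :: nat}" A X A "\<lambda>p. h p \<one>"] assms(1) sub by force
  have shift_closed: "shift G g x \<in> carrier G \<rightarrow>\<^sub>E B" if "g \<in> carrier G" "x \<in> carrier G \<rightarrow>\<^sub>E B"
    for g B and x :: "'a \<Rightarrow> 'd"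
    using that by (auto simp: shift_def PiE_iff)
  have at_one: "h (t, x, y) g = h (shift G (inv g) t, shift G (inv g) x, shift G (inv g) y) \<one>"
    if "t \<in> carrier G \<rightarrow>\<^sub>E {0, 1}" "x \<in> X" "y \<in> X" "g \<in> carrier G" for t x y g
  proof -
    have "(t, x, y) \<in> topspace ?P"
      using that topP by simp
    then have "h (shift G (inv g) t, shift G (inv g) x, shift G (inv g) y) = shift G (inv g) (h (t, x, y))"
      using block that(4) by (auto simp: block_map_def)
    then show ?thesis
      using that(4) by (simp add: shift_apply)
  qed
  have loc: "h (t, x, y) g = h (t', x', y') g'"
    if "t \<in> carrier G \<rightarrow>\<^sub>E {0, 1}" "t' \<in> carrier G \<rightarrow>\<^sub>E {0, 1}"
      "x \<in> X" "x' \<in> X" "y \<in> X" "y' \<in> X" "g \<in> carrier G" "g' \<in> carrier G"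
      "\<And>b. b \<in> wball R \<Longrightarrow> t (g \<otimes> b) = t' (g' \<otimes> b) \<and> x (g \<otimes> b) = x' (g' \<otimes> b) \<and> y (g \<otimes> b) = y' (g' \<otimes> b)"
    for t t' x x' y y' g g'
    unfolding at_one[OF that(1,3,5,7)] at_one[OF that(2,4,6,8)]
    using that sub
    by (intro R) (auto simp: shift_apply subshift_def intro!: shift_closed)
  define ind where "ind U = (\<lambda>g\<in>carrier G. if g \<in> U then 1 else 0 :: nat)" for U
  have ind: "ind U \<in> carrier G \<rightarrow>\<^sub>E {0, 1}" for U
    by (auto simp: ind_def)
  have const: "constant_config G i \<in> carrier G \<rightarrow>\<^sub>E {0, 1}" if "i \<in> {0, 1 :: nat}" for i
    using that by (auto simp: constant_config_def)
  have "gluing G S A X (\<lambda>U x y. h (ind U, x, y)) R"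
  proof
    show "finite A" "subshift G A X"
      by fact+
    fix x y U
    assume xy: "x \<in> X" "y \<in> X"
    then show "h (ind U, x, y) \<in> X"
      using hX ind by blast
    fix g assume g: "g \<in> carrier G"
    show "h (ind U, x, y) g = y g" if "\<And>b. b \<in> wball R \<Longrightarrow> g \<otimes> b \<in> U"
    proof -
      have "h (ind U, x, y) g = h (constant_config G 1, x, y) g"
        using g xy that by (intro loc ind const) (auto simp: ind_def constant_config_def)
      then show ?thesis
        using ends xy by simp
    qed
    show "h (ind U, x, y) g = x g" if "\<And>b. b \<in> wball R \<Longrightarrow> g \<otimes> b \<notin> U"
    proof -
      have "h (ind U, x, y) g = h (constant_config G 0, x, y) g"
        using g xy that by (intro loc ind const) (auto simp: ind_def constant_config_def)
      then show ?thesis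
        using ends xy by simp
    qed
    fix g' assume "g' \<in> carrier G"
      and "\<And>b. b \<in> wball R \<Longrightarrow> (g \<otimes> b \<in> U \<longleftrightarrow> g' \<otimes> b \<in> U) \<and>
        x (g \<otimes> b) = x (g' \<otimes> b) \<and> y (g \<otimes> b) = y (g' \<otimes> b)"
    then show "h (ind U, x, y) g = h (ind U, x, y) g'"
      using g xy by (intro loc ind) (auto simp: ind_def)
  qed
  then show thesis
    by (rule that)
qed

context word_metric
begin

lemma dist_mult:
  "a \<in> carrier G \<Longrightarrow> g \<in> carrier G \<Longrightarrow> inv a \<otimes> g \<in> wball m \<Longrightarrow> b \<in> wball n \<Longrightarrow>
    inv a \<otimes> (g \<otimes> b) \<in> wball (m + n)"
  using mult_wball[of "inv a \<otimes> g" m b n] wball_closed[of b n] by (simp add: m_assoc)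

lemma dist_common:
  "a \<in> carrier G \<Longrightarrow> b \<in> carrier G \<Longrightarrow> g \<in> carrier G \<Longrightarrow>
    inv a \<otimes> g \<in> wball m \<Longrightarrow> inv b \<otimes> g \<in> wball n \<Longrightarrow> inv a \<otimes> b \<in> wball (m + n)"
  using dist_triangle dist_sym by blast

end

section \<open>Pasting periodic points\<close>

context gluing
begin

lemma shift_closed: "g \<in> carrier G \<Longrightarrow> x \<in> X \<Longrightarrow> shift G g x \<in> X"
  using subshift by (simp add: subshift_def)

text \<open>The induction runs over labels, since there may be infinitely many patches: all patches
  labelled \<open>q\<close> show the same point \<open>shift G q w\<close>, so one gluing installs
  them together. Patches with other labels are too far away to be disturbed.\<close>

lemma scattered_patches_finite:
  assumes w: "w \<in> X" and V: "V \<subseteq> carrier G" and k: "k ` V \<subseteq> carrier G"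
    and close: "\<And>a b. a \<in> V \<Longrightarrow> b \<in> V \<Longrightarrow> inv a \<otimes> b \<in> wball (2 * \<rho> + 2 * R) \<Longrightarrow> k a = k b"
    and Q: "finite Q" "Q \<subseteq> carrier G"
  shows "\<exists>Z\<in>X. \<forall>a\<in>V. \<forall>g\<in>carrier G. k a \<in> Q \<longrightarrow> inv a \<otimes> g \<in> wball \<rho> \<longrightarrow> Z g = w (inv (k a) \<otimes> g)"
  using Q
proof (induction Q rule: finite_induct)
  case empty
  then show ?case
    using w by auto
next
  case (insert q Q)
  then obtain Z where Z: "Z \<in> X"
    "\<And>a g. a \<in> V \<Longrightarrow> g \<in> carrier G \<Longrightarrow> k a \<in> Q \<Longrightarrow> inv a \<otimes> g \<in> wball \<rho> \<Longrightarrow> Z g = w (inv (k a) \<otimes> g)"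
    by force
  have q: "q \<in> carrier G" "shift G q w \<in> X"
    using insert.prems w shift_closed by auto
  \<comment> \<open>The extra \<open>R\<close> puts the \<open>\<rho>\<close>-balls at depth
    \<open>R\<close> in \<open>U\<close>, as \<open>glue_inside\<close> demands.\<close>
  define U where "U = {g \<in> carrier G. \<exists>a\<in>V. k a = q \<and> inv a \<otimes> g \<in> wball (\<rho> + R)}"
  show ?case
  proof (intro bexI[of _ "glue U Z (shift G q w)"] ballI impI)
    fix a g
    assume a: "a \<in> V" and g: "g \<in> carrier G" and ka: "k a \<in> insert q Q" and near: "inv a \<otimes> g \<in> wball \<rho>"
    have ac: "a \<in> carrier G"
      using a V by auto
    have gb: "g \<otimes> b \<in> carrier G" "inv a \<otimes> (g \<otimes> b) \<in> wball (\<rho> + R)" if "b \<in> wball R" for b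
      using dist_mult[OF ac g near that] wball_closed[OF that] g by auto
    show "glue U Z (shift G q w) g = w (inv (k a) \<otimes> g)"
    proof (cases "k a = q")
      case True
      then have "glue U Z (shift G q w) g = shift G q w g"
        using Z q g gb a by (intro glue_inside) (auto simp: U_def)
      then show ?thesis
        using g True by (simp add: shift_apply)
    next
      case False
      have "g \<otimes> b \<notin> U" if b: "b \<in> wball R" for b
      proof
        assume "g \<otimes> b \<in> U"
        then obtain a' where a': "a' \<in> V" "k a' = q" "inv a' \<otimes> (g \<otimes> b) \<in> wball (\<rho> + R)"
          by (auto simp: U_def)
        \<comment> \<open>Both centres are within \<open>\<rho> + R\<close> of the common point
          \<open>g \<otimes> b\<close>; this is the source of the bound in
          \<open>close\<close>.\<close>
        then have "inv a \<otimes> a' \<in> wball (\<rho> + R + (\<rho> + R))"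
          using dist_common[of a a' "g \<otimes> b"] gb[OF b] ac V by blast
        moreover have "\<rho> + R + (\<rho> + R) = 2 * \<rho> + 2 * R"
          by simp
        ultimately have "k a = k a'"
          using close[OF a a'(1)] by metis
        then show False
          using a' False by simp
      qed
      then have "glue U Z (shift G q w) g = Z g"
        using Z q g by (intro glue_outside) auto
      then show ?thesis
        using Z(2) a g ka False near by auto
    qed
  qed (use Z q glue_closed in blast)
qed

text \<open>Finitely many coordinates involve finitely many labels, so the finite version handles
  each finite part and compactness assembles them.\<close>

lemma scattered_patches:
  assumes w: "w \<in> X" and V: "V \<subseteq> carrier G" and k: "k ` V \<subseteq> carrier G"
    and close: "\<And>a b. a \<in> V \<Longrightarrow> b \<in> V \<Longrightarrow> inv a \<otimes> b \<in> wball (2 * \<rho> + 2 * R) \<Longrightarrow> k a = k b"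
  obtains Z where "Z \<in> X"
    and "\<And>a g. a \<in> V \<Longrightarrow> g \<in> carrier G \<Longrightarrow> inv a \<otimes> g \<in> wball \<rho> \<Longrightarrow> Z g = w (inv (k a) \<otimes> g)"
proof -
  define D where "D = {g \<in> carrier G. \<exists>a\<in>V. inv a \<otimes> g \<in> wball \<rho>}"
  \<comment> \<open>The choice of centre does not affect the prescribed value: centres within
    \<open>\<rho>\<close> of the same point carry the same label.\<close>
  define c where "c g = (SOME a. a \<in> V \<and> inv a \<otimes> g \<in> wball \<rho>)" for g
  have c: "c g \<in> V" "inv (c g) \<otimes> g \<in> wball \<rho>" if "g \<in> D" for g
    using that someI_ex[of "\<lambda>a. a \<in> V \<and> inv a \<otimes> g \<in> wball \<rho>"] by (auto simp: D_def c_def)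
  have "\<exists>Z\<in>X. \<forall>g\<in>D. Z g = w (inv (k (c g)) \<otimes> g)"
  proof (rule subshift_compactness[OF subshift finite_alphabet])
    show "D \<subseteq> carrier G"
      by (auto simp: D_def)
    fix F assume F: "finite F" "F \<subseteq> D"
    then have "finite (k ` c ` F)" "k ` c ` F \<subseteq> carrier G"
      using k c by auto
    then obtain Z where Z: "Z \<in> X" "\<forall>a\<in>V. \<forall>g\<in>carrier G. k a \<in> k ` c ` F \<longrightarrow> inv a \<otimes> g \<in> wball \<rho> \<longrightarrow>
        Z g = w (inv (k a) \<otimes> g)"
      using scattered_patches_finite[OF w V k close, of \<rho> "k ` c ` F"] by fast
    have "Z g = w (inv (k (c g)) \<otimes> g)" if "g \<in> F" for g
    proof -
      have "g \<in> D" "g \<in> carrier G"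
        using that F by (auto simp: D_def)
      then show ?thesis
        using Z(2) c[of g] that by blast
    qed
    with Z(1) show "\<exists>Z\<in>X. \<forall>g\<in>F. Z g = w (inv (k (c g)) \<otimes> g)"
      by blast
  qed
  then obtain Z where Z: "Z \<in> X" "\<And>g. g \<in> D \<Longrightarrow> Z g = w (inv (k (c g)) \<otimes> g)"
    by blast
  show thesis
  proof (rule that[OF Z(1)])
    fix a g assume a: "a \<in> V" and g: "g \<in> carrier G" and near: "inv a \<otimes> g \<in> wball \<rho>"
    then have gD: "g \<in> D"
      by (auto simp: D_def)
    have "inv a \<otimes> c g \<in> wball (\<rho> + \<rho>)"
      using dist_common[OF _ _ g near c(2)[OF gD]] a c(1)[OF gD] V by auto
    then have "inv a \<otimes> c g \<in> wball (2 * \<rho> + 2 * R)"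
      using wball_mono[of "\<rho> + \<rho>" "2 * \<rho> + 2 * R"] by auto
    then have "k a = k (c g)"
      using close a c(1)[OF gD] by blast
    then show "Z g = w (inv (k a) \<otimes> g)"
      using Z(2)[OF gD] by simp
  qed
qed

text \<open>Pasting translates of \<open>w\<close> near \<open>V\<close> onto a point that is \<open>H\<close>-periodic on \<open>D\<close> costs a
  layer of thickness \<open>R\<close> of \<open>D\<close>: within \<open>R\<close> of the seam the values are read off both points,
  which are both periodic there.\<close>

lemma paste_periodic:
  assumes H: "subgroup H G" and Y: "Y \<in> X" and w: "w \<in> X"
    and V: "V \<subseteq> carrier G" "\<And>h a. h \<in> H \<Longrightarrow> a \<in> V \<Longrightarrow> h \<otimes> a \<in> V"
    and k: "\<And>a. a \<in> V \<Longrightarrow> k a \<in> H" "\<And>h a. h \<in> H \<Longrightarrow> a \<in> V \<Longrightarrow> k (h \<otimes> a) = h \<otimes> k a"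
    and close: "\<And>a b. a \<in> V \<Longrightarrow> b \<in> V \<Longrightarrow> inv a \<otimes> b \<in> wball (2 * \<rho> + 8 * R) \<Longrightarrow> k a = k b"
    and D: "\<And>g h. g \<in> D \<Longrightarrow> h \<in> H \<Longrightarrow> Y (h \<otimes> g) = Y g"
  obtains Y' where "Y' \<in> X"
    and "\<And>a g. a \<in> V \<Longrightarrow> g \<in> carrier G \<Longrightarrow> inv a \<otimes> g \<in> wball \<rho> \<Longrightarrow> Y' g = w (inv (k a) \<otimes> g)"
    and "\<And>a g h. a \<in> V \<Longrightarrow> g \<in> carrier G \<Longrightarrow> inv a \<otimes> g \<in> wball \<rho> \<Longrightarrow> h \<in> H \<Longrightarrow> Y' (h \<otimes> g) = Y' g"
    and "\<And>g h. g \<in> carrier G \<Longrightarrow> (\<And>b. b \<in> wball R \<Longrightarrow> g \<otimes> b \<in> D) \<Longrightarrow> h \<in> H \<Longrightarrow> Y' (h \<otimes> g) = Y' g"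
proof -
  note Hc [simp] = subgroup.mem_carrier[OF H]
  have Vc [simp]: "a \<in> carrier G" if "a \<in> V" for a
    using that V by auto
  have kc: "k ` V \<subseteq> carrier G"
    using k(1) by auto
  \<comment> \<open>The gluing set \<open>U\<close> reaches to \<open>\<rho> + R\<close> from
    \<open>V\<close>; a point whose \<open>R\<close>-ball meets \<open>U\<close> is within
    \<open>\<rho> + 2 * R\<close>, and its own \<open>R\<close>-ball within
    \<open>\<rho> + 3 * R\<close>. \<open>Z\<close> has to be controlled that far.\<close>
  have "2 * (\<rho> + 3 * R) + 2 * R = 2 * \<rho> + 8 * R"
    by simp
  then obtain Z where Z: "Z \<in> X" "\<And>a g. a \<in> V \<Longrightarrow> g \<in> carrier G \<Longrightarrow> inv a \<otimes> g \<in> wball (\<rho> + 3 * R) \<Longrightarrow>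
      Z g = w (inv (k a) \<otimes> g)"
    using scattered_patches[OF w V(1) kc, of "\<rho> + 3 * R"] close by metis
  \<comment> \<open>Equivariance of the labels cancels the translation by \<open>h\<close>, so
    translated patches have equal content and \<open>Z\<close> is \<open>H\<close>-periodic near
    \<open>V\<close>.\<close>
  have patch: "w (inv (k (h \<otimes> a)) \<otimes> (h \<otimes> g)) = w (inv (k a) \<otimes> g)"
    if "h \<in> H" "a \<in> V" "g \<in> carrier G" for h a g
    using that k dist_translate[of h "k a" g] by simp
  have Z_per: "Z (h \<otimes> g) = Z g"
    if "a \<in> V" "g \<in> carrier G" "inv a \<otimes> g \<in> wball (\<rho> + 3 * R)" "h \<in> H" for a g h
    using that Z(2)[of a g] Z(2)[of "h \<otimes> a" "h \<otimes> g"] V(2) patch by (simp add: dist_translate)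
  define U where "U = {g \<in> carrier G. \<exists>a\<in>V. inv a \<otimes> g \<in> wball (\<rho> + R)}"
  have U_step: "h \<otimes> g \<in> U" if "g \<in> U" "h \<in> H" for h g
  proof -
    from \<open>g \<in> U\<close> obtain a where a: "g \<in> carrier G" "a \<in> V" "inv a \<otimes> g \<in> wball (\<rho> + R)"
      by (auto simp: U_def)
    then have "inv (h \<otimes> a) \<otimes> (h \<otimes> g) \<in> wball (\<rho> + R)"
      using that(2) by (simp add: dist_translate)
    then show ?thesis
      using a that(2) V(2) unfolding U_def by auto
  qed
  have U_inv: "h \<otimes> g \<in> U \<longleftrightarrow> g \<in> U" if "g \<in> carrier G" "h \<in> H" for h g
    using that U_step[of g h] U_step[of "h \<otimes> g" "inv h"] subgroup.m_inv_closed[OF H] by auto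
  define Y' where "Y' = glue U Y Z"
  have Y'_patch: "Y' g = w (inv (k a) \<otimes> g)"
    if "a \<in> V" "g \<in> carrier G" "inv a \<otimes> g \<in> wball \<rho>" for a g
  proof -
    have "g \<otimes> b \<in> U" if "b \<in> wball R" for b
      using dist_mult[of a g \<rho> b R] \<open>a \<in> V\<close> \<open>g \<in> carrier G\<close> \<open>inv a \<otimes> g \<in> wball \<rho>\<close> that
        wball_closed[OF that] by (auto simp: U_def)
    then have "Y' g = Z g"
      unfolding Y'_def using Y Z(1) that by (intro glue_inside)
    then show ?thesis
      using Z(2) that wball_mono[of \<rho> "\<rho> + 3 * R"] by auto
  qed
  show thesis
  proof (rule that)
    show "Y' \<in> X"
      unfolding Y'_def using Y Z(1) by (rule glue_closed)
    show "Y' g = w (inv (k a) \<otimes> g)" if "a \<in> V" "g \<in> carrier G" "inv a \<otimes> g \<in> wball \<rho>" for a g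
      using Y'_patch that by blast
    show "Y' (h \<otimes> g) = Y' g" if "a \<in> V" "g \<in> carrier G" "inv a \<otimes> g \<in> wball \<rho>" "h \<in> H" for a g h
      using that Y'_patch[of a g] Y'_patch[of "h \<otimes> a" "h \<otimes> g"] V(2) patch by (simp add: dist_translate)
    show "Y' (h \<otimes> g) = Y' g"
      if g: "g \<in> carrier G" and gD: "\<And>b. b \<in> wball R \<Longrightarrow> g \<otimes> b \<in> D" and h: "h \<in> H" for g h
    proof (cases "\<exists>b\<in>wball R. g \<otimes> b \<in> U")
      case False
      then have "Y' g = Y g"
        unfolding Y'_def using Y Z(1) g by (intro glue_outside) auto
      moreover have "Y' (h \<otimes> g) = Y (h \<otimes> g)"
        unfolding Y'_def using Y Z(1) g h False
        by (intro glue_outside) (auto simp: U_inv m_assoc)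
      moreover have "g \<in> D"
        using gD[of \<one>] g by simp
      ultimately show ?thesis
        using D h by simp
    next
      case True
      then obtain b a where ab: "b \<in> wball R" "a \<in> V" "inv a \<otimes> (g \<otimes> b) \<in> wball (\<rho> + R)"
        by (auto simp: U_def)
      have "inv a \<otimes> ((g \<otimes> b) \<otimes> inv b) \<in> wball (\<rho> + R + R)"
        by (rule dist_mult) (use ab g in auto)
      then have near: "inv a \<otimes> g \<in> wball (\<rho> + R + R)"
        using ab(1) g by (simp add: m_assoc)
      \<comment> \<open>The \<open>R\<close>-ball around \<open>g\<close> lies in \<open>D\<close>
        and within \<open>\<rho> + 3 * R\<close> of \<open>a\<close>, so \<open>U\<close>,
        \<open>Y\<close> and \<open>Z\<close> all look the same around \<open>g\<close> and
        \<open>h \<otimes> g\<close>.\<close>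
      have "glue U Y Z (h \<otimes> g) = glue U Y Z g"
      proof (rule glue_local[OF Y Z(1)])
        fix b' assume b': "b' \<in> wball R"
        have "inv a \<otimes> (g \<otimes> b') \<in> wball (\<rho> + R + R + R)"
          by (rule dist_mult) (use ab g near b' in auto)
        then have "inv a \<otimes> (g \<otimes> b') \<in> wball (\<rho> + 3 * R)"
          by (simp add: numeral_3_eq_3 add.assoc)
        then have "Z (h \<otimes> (g \<otimes> b')) = Z (g \<otimes> b')"
          using Z_per ab(2) g h b' by auto
        then show "(h \<otimes> g \<otimes> b' \<in> U \<longleftrightarrow> g \<otimes> b' \<in> U) \<and> Y (h \<otimes> g \<otimes> b') = Y (g \<otimes> b') \<and>
            Z (h \<otimes> g \<otimes> b') = Z (g \<otimes> b')"
          using g h b' gD[OF b'] D U_inv by (simp add: m_assoc)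
      qed (use g h in auto)
      then show ?thesis
        by (simp add: Y'_def)
    qed
  qed
qed

text \<open>The radii form a budget: after \<open>m\<close> colours, periodicity holds within
  \<open>(n - m) * R\<close> of the first \<open>m\<close> classes. A new class gets radius
  \<open>n * R\<close>, while the old ones lose \<open>R\<close>. Radius 0 remains after
  \<open>n\<close> rounds, which suffices because the classes cover the group.\<close>

lemma periodic_from_cover:
  fixes n :: nat and V :: "nat \<Rightarrow> 'a set"
  assumes H: "subgroup H G" and w: "w \<in> X"
    and V: "\<And>c. V c \<subseteq> carrier G" "\<And>c h a. h \<in> H \<Longrightarrow> a \<in> V c \<Longrightarrow> h \<otimes> a \<in> V c"
    and k: "\<And>c a. a \<in> V c \<Longrightarrow> k c a \<in> H"
      "\<And>c h a. h \<in> H \<Longrightarrow> a \<in> V c \<Longrightarrow> k c (h \<otimes> a) = h \<otimes> k c a"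
    and close: "\<And>c a b. a \<in> V c \<Longrightarrow> b \<in> V c \<Longrightarrow> inv a \<otimes> b \<in> wball (2 * (n * R) + 8 * R) \<Longrightarrow>
      k c a = k c b"
    and cover: "carrier G \<subseteq> (\<Union>c\<in>{1..n}. V c)"
  obtains Y where "Y \<in> X" "\<And>g h. g \<in> carrier G \<Longrightarrow> h \<in> H \<Longrightarrow> Y (h \<otimes> g) = Y g"
proof -
  have "\<exists>Y\<in>X. \<forall>c\<in>{1..m}. \<forall>a\<in>V c. \<forall>g\<in>carrier G. inv a \<otimes> g \<in> wball ((n - m) * R) \<longrightarrow>
      (\<forall>h\<in>H. Y (h \<otimes> g) = Y g)" if "m \<le> n" for m
    using that
  proof (induction m)
    case 0
    then show ?case
      using w by auto
  next
    case (Suc m)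
    then obtain Y where Y: "Y \<in> X" "\<forall>c\<in>{1..m}. \<forall>a\<in>V c. \<forall>g\<in>carrier G.
        inv a \<otimes> g \<in> wball ((n - m) * R) \<longrightarrow> (\<forall>h\<in>H. Y (h \<otimes> g) = Y g)"
      by auto
    define D where "D = {g \<in> carrier G. \<exists>c\<in>{1..m}. \<exists>a\<in>V c. inv a \<otimes> g \<in> wball ((n - m) * R)}"
    have D: "\<And>g h. g \<in> D \<Longrightarrow> h \<in> H \<Longrightarrow> Y (h \<otimes> g) = Y g"
      using Y(2) by (auto simp: D_def)
    obtain Y' where Y': "Y' \<in> X"
      "\<And>a g h. a \<in> V (Suc m) \<Longrightarrow> g \<in> carrier G \<Longrightarrow> inv a \<otimes> g \<in> wball (n * R) \<Longrightarrow> h \<in> H \<Longrightarrow>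
        Y' (h \<otimes> g) = Y' g"
      "\<And>g h. g \<in> carrier G \<Longrightarrow> (\<And>b. b \<in> wball R \<Longrightarrow> g \<otimes> b \<in> D) \<Longrightarrow> h \<in> H \<Longrightarrow> Y' (h \<otimes> g) = Y' g"
    proof (rule paste_periodic[OF H Y(1) w V(1,2)[where c = "Suc m"] k[where c = "Suc m"] close D])
      fix Y' assume "Y' \<in> X"
        "\<And>a g h. a \<in> V (Suc m) \<Longrightarrow> g \<in> carrier G \<Longrightarrow> inv a \<otimes> g \<in> wball (n * R) \<Longrightarrow> h \<in> H \<Longrightarrow>
          Y' (h \<otimes> g) = Y' g"
        "\<And>g h. g \<in> carrier G \<Longrightarrow> (\<And>b. b \<in> wball R \<Longrightarrow> g \<otimes> b \<in> D) \<Longrightarrow> h \<in> H \<Longrightarrow> Y' (h \<otimes> g) = Y' g"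
      then show thesis
        by (rule that)
    qed
    show ?case
    proof (intro bexI[OF _ Y'(1)] ballI impI)
      fix c a g h
      assume c: "c \<in> {1..Suc m}" and a: "a \<in> V c" and g: "g \<in> carrier G"
        and near: "inv a \<otimes> g \<in> wball ((n - Suc m) * R)" and h: "h \<in> H"
      show "Y' (h \<otimes> g) = Y' g"
      proof (cases "c = Suc m")
        case True
        have "inv a \<otimes> g \<in> wball (n * R)"
          using near wball_mono[of "(n - Suc m) * R" "n * R"] by auto
        then show ?thesis
          using Y'(2) a g h True by blast
      next
        case False
        then have cm: "c \<in> {1..m}"
          using c by auto
        \<comment> \<open>As \<open>Suc m \<le> n\<close>, no truncation occurs and exactly one
          layer \<open>R\<close> is spent.\<close>
        have "n - m = Suc (n - Suc m)"
          using Suc.prems by simp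
        then have *: "(n - m) * R = (n - Suc m) * R + R"
          by simp
        have "g \<otimes> b \<in> D" if "b \<in> wball R" for b
        proof -
          have "a \<in> carrier G"
            using a V(1) by blast
          then have "inv a \<otimes> (g \<otimes> b) \<in> wball ((n - m) * R)"
            using dist_mult[OF _ g near that] by (simp add: *)
          then show ?thesis
            using a g cm that unfolding D_def by auto
        qed
        then show ?thesis
          using Y'(3) g h by blast
      qed
    qed
  qed
  from this[of n] obtain Y where Y: "Y \<in> X" "\<forall>c\<in>{1..n}. \<forall>a\<in>V c. \<forall>g\<in>carrier G.
      inv a \<otimes> g \<in> wball ((n - n) * R) \<longrightarrow> (\<forall>h\<in>H. Y (h \<otimes> g) = Y g)"
    by auto
  show thesis
  proof (rule that[OF Y(1)])
    fix g h assume "g \<in> carrier G" "h \<in> H"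
    moreover from this obtain c where "c \<in> {1..n}" "g \<in> V c"
      using cover by auto
    ultimately show "Y (h \<otimes> g) = Y g"
      using Y(2) by auto
  qed
qed

text \<open>The scale of the colouring is the closeness that \<open>periodic_from_cover\<close>
  demands for \<open>n\<close> colours: points of one colour that close are adjacent, hence in one
  component and equally labelled.\<close>

lemma periodic_point_near:
  assumes rf: "residually_finite G" and w: "w \<in> X" and F: "finite F" "F \<subseteq> carrier G"
    and x: "x \<in> bounded_colorings G S n (2 * (n * R) + 8 * R) m" and px: "periodic G x"
  obtains Y where "Y \<in> X" "periodic G Y" "\<And>g. g \<in> F \<Longrightarrow> Y g = w g"
proof -
  define r where "r = 2 * (n * R) + 8 * R"
  obtain \<rho> where \<rho>: "F \<subseteq> wball \<rho>"
    using finite_subset_wball F by blast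
  \<comment> \<open>The first summand bounds the diameter of a component; the second is the
    separation of patches needed in the last paste. One subgroup has to serve both.\<close>
  define M where "M = m * m * r + (2 * \<rho> + 8 * R)"
  have "finite (wball M - {\<one>})" "wball M - {\<one>} \<subseteq> carrier G" "\<one> \<notin> wball M - {\<one>}"
    using finite_wball wball_carrier by auto
  then obtain N where N: "N \<lhd> G" "finite_index G N" "N \<inter> (wball M - {\<one>}) = {}"
    using residually_finite_avoid[OF rf] by blast
  \<comment> \<open>The stabilizer keeps the colour classes invariant; \<open>N\<close> makes
    nontrivial elements move every point farther than \<open>M\<close>.\<close>
  define H where "H = stabilizer G (shift G) x \<inter> N"
  have fH: "finite_index G H"
    using px N(2) unfolding H_def periodic_def by (rule finite_index_Int)
  then have H: "subgroup H G"
    by (simp add: finite_index_def)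
  note Hc = subgroup.mem_carrier[OF H]
  \<comment> \<open>The distance from \<open>a\<close> to \<open>h \<otimes> a\<close> is the norm
    of a conjugate of \<open>h\<close>. By normality it lies in \<open>N\<close>, which meets the
    ball only in the identity.\<close>
  have free: "h = \<one>" if "h \<in> H" "a \<in> carrier G" "inv a \<otimes> (h \<otimes> a) \<in> wball M" for h a
  proof -
    have "inv a \<otimes> h \<otimes> inv (inv a) \<in> N"
      using N(1) that unfolding normal_inv_iff H_def by (metis IntD2 inv_closed)
    then have "inv a \<otimes> (h \<otimes> a) \<in> N"
      using that Hc by (simp add: m_assoc)
    then have "inv a \<otimes> (h \<otimes> a) = \<one>"
      using N(3) that by blast
    then have "a \<otimes> (inv a \<otimes> (h \<otimes> a)) = a"
      using that by simp
    then show ?thesis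
      using that Hc by simp
  qed
  define V where "V c = {a \<in> carrier G. x a = c \<and> c \<in> {1..n}}" for c
  have Vc: "V c \<subseteq> carrier G" for c
    by (auto simp: V_def)
  have VH: "h \<otimes> a \<in> V c" if "h \<in> H" "a \<in> V c" for h a c
    using that stabilizer_shiftD[of h x a] Hc by (auto simp: V_def H_def)
  define E where "E c = color_edges G S r x c" for c
  have E_iff: "(a, b) \<in> E c \<longleftrightarrow> a \<in> carrier G \<and> b \<in> carrier G \<and> x a = c \<and> x b = c \<and> inv a \<otimes> b \<in> wball r"
    for a b c
    by (auto simp: E_def color_edges_def wball_def simp del: wball_closed)
  have E_pow: "a \<in> carrier G \<Longrightarrow> (a, b) \<in> E c ^^ i \<Longrightarrow> b \<in> carrier G \<and> inv a \<otimes> b \<in> wball (i * r)" for a b c i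
  proof (induction i arbitrary: b)
    case (Suc i)
    then obtain d where d: "(a, d) \<in> E c ^^ i" "(d, b) \<in> E c"
      by auto
    then have "d \<in> carrier G" "inv a \<otimes> d \<in> wball (i * r)" "b \<in> carrier G" "inv d \<otimes> b \<in> wball r"
      using Suc E_iff by blast+
    then show ?case
      using dist_triangle[of a d b "i * r" r] Suc.prems by (simp add: add.commute)
  qed auto
  \<comment> \<open>Reachability is reflexive on the whole type; cutting it down to
    \<open>V c\<close> makes it an equivalence on \<open>V c\<close>.\<close>
  define Q where "Q c = (E c)\<^sup>* \<inter> V c \<times> V c" for c
  have labels: "\<exists>k. (\<forall>a\<in>V c. k a \<in> H) \<and> (\<forall>h\<in>H. \<forall>a\<in>V c. k (h \<otimes> a) = h \<otimes> k a) \<and> (\<forall>(a, b)\<in>Q c. k a = k b)" for c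
  proof -
    have symE: "sym (E c)"
      using dist_sym by (auto simp: E_iff intro!: symI)
    have eqQ: "equiv (V c) (Q c)"
      using sym_rtrancl[OF symE] 
      by (auto simp: Q_def equiv_def refl_on_def sym_def trans_def intro: rtrancl_trans)
    have invQ: "(h \<otimes> a, h \<otimes> b) \<in> Q c" if "h \<in> H" "(a, b) \<in> Q c" for h a b
    proof -
      have "(a, b) \<in> (E c)\<^sup>*"
        using that by (simp add: Q_def)
      then have "(h \<otimes> a, h \<otimes> b) \<in> (E c)\<^sup>*"
      proof induction
        case (step y z)
        have "(h \<otimes> y, h \<otimes> z) \<in> E c"
          using step(2) that(1) Hc stabilizer_shiftD[of h x] by (auto simp: E_iff dist_translate H_def)
        with step show ?case
          by (meson rtrancl.rtrancl_into_rtrancl)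
      qed simp
      then show ?thesis
        using that VH by (auto simp: Q_def)
    qed
    \<comment> \<open>If \<open>a\<close> and \<open>h \<otimes> a\<close> share a component, the
      path bound places them within \<open>m * m * r\<close>, hence within \<open>M\<close>.\<close>
    have freeQ: "h = \<one>" if "h \<in> H" "(a, h \<otimes> a) \<in> Q c" for h a
    proof -
      have a: "a \<in> carrier G" "x a = c" "c \<in> {1..n}" "(a, h \<otimes> a) \<in> (E c)\<^sup>*"
        using that by (auto simp: Q_def V_def)
      then have "finite ((E c)\<^sup>* `` {a})" "card ((E c)\<^sup>* `` {a}) \<le> m"
        using x by (auto simp: bounded_colorings_def Let_def E_def r_def)
      then obtain i where i: "i \<le> m * m" "(a, h \<otimes> a) \<in> E c ^^ i"
        using rtrancl_relpow_bound a(4) by metis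
      have "i * r \<le> M"
        using i(1) unfolding M_def by (meson mult_le_mono1 trans_le_add1)
      then have "inv a \<otimes> (h \<otimes> a) \<in> wball M"
        using E_pow[OF a(1) i(2)] wball_mono by blast
      then show ?thesis
        using free that(1) a(1) by blast
    qed
    show ?thesis
      by (rule equivariant_label[OF H Vc VH eqQ invQ freeQ]) blast+
  qed
  obtain k where k: "\<And>c a. a \<in> V c \<Longrightarrow> k c a \<in> H"
    "\<And>c h a. h \<in> H \<Longrightarrow> a \<in> V c \<Longrightarrow> k c (h \<otimes> a) = h \<otimes> k c a"
    "\<And>c a b. (a, b) \<in> Q c \<Longrightarrow> k c a = k c b"
  proof -
    obtain k where "\<forall>c. (\<forall>a\<in>V c. k c a \<in> H) \<and> (\<forall>h\<in>H. \<forall>a\<in>V c. k c (h \<otimes> a) = h \<otimes> k c a) \<and>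
        (\<forall>(a, b)\<in>Q c. k c a = k c b)"
      by (rule choice[OF allI, THEN exE, OF labels])
    then show thesis
      by (intro that[of k]) auto
  qed
  have close: "k c a = k c b"
    if "a \<in> V c" "b \<in> V c" "inv a \<otimes> b \<in> wball (2 * (n * R) + 8 * R)" for c a b
  proof -
    have "(a, b) \<in> E c"
      using that by (auto simp: E_iff V_def r_def)
    then show ?thesis
      using that k(3) by (auto simp: Q_def)
  qed
  have cover: "carrier G \<subseteq> (\<Union>c\<in>{1..n}. V c)"
    using x by (auto simp: V_def bounded_colorings_def topspace_full_shift)
  obtain Y where Y: "Y \<in> X" "\<And>g h. g \<in> carrier G \<Longrightarrow> h \<in> H \<Longrightarrow> Y (h \<otimes> g) = Y g"
  proof (rule periodic_from_cover[OF H w Vc VH k(1,2) close cover])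
    fix Y assume "Y \<in> X" "\<And>g h. g \<in> carrier G \<Longrightarrow> h \<in> H \<Longrightarrow> Y (h \<otimes> g) = Y g"
    then show thesis
      by (rule that)
  qed
  \<comment> \<open>Distinct elements of \<open>H\<close> are so far apart that \<open>H\<close>
    itself, labelled by the identity map, is an admissible set of centres.\<close>
  have sep: "a = b" if "a \<in> H" "b \<in> H" "inv a \<otimes> b \<in> wball (2 * \<rho> + 8 * R)" for a b
  proof -
    have "inv a \<otimes> b \<in> wball M"
      using that(3) wball_mono[of "2 * \<rho> + 8 * R" M] by (auto simp: M_def)
    moreover have "inv a \<otimes> b \<in> H"
      using that(1,2) H by (simp add: subgroup.m_closed subgroup.m_inv_closed)
    ultimately have "inv a \<otimes> b = \<one>"
      using free[of "inv a \<otimes> b" \<one>] Hc by simp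
    then have "a \<otimes> (inv a \<otimes> b) = a"
      using that Hc by simp
    then show ?thesis
      using that Hc by simp
  qed
  \<comment> \<open>\<open>Y\<close> is periodic on the whole group, so with \<open>D\<close> the
    carrier no layer is lost: \<open>Y'\<close> stays periodic everywhere and shows a copy of
    \<open>w\<close> around each element of \<open>H\<close>, including the identity.\<close>
  obtain Y' where Y': "Y' \<in> X"
    "\<And>a g. a \<in> H \<Longrightarrow> g \<in> carrier G \<Longrightarrow> inv a \<otimes> g \<in> wball \<rho> \<Longrightarrow> Y' g = w (inv a \<otimes> g)"
    "\<And>g h. g \<in> carrier G \<Longrightarrow> (\<And>b. b \<in> wball R \<Longrightarrow> g \<otimes> b \<in> carrier G) \<Longrightarrow> h \<in> H \<Longrightarrow> Y' (h \<otimes> g) = Y' g"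
  proof (rule paste_periodic[OF H Y(1) w, of H "\<lambda>a. a" \<rho> "carrier G"])
    show "H \<subseteq> carrier G"
      using H by (rule subgroup.subset)
    fix Y' assume "Y' \<in> X"
      "\<And>a g. a \<in> H \<Longrightarrow> g \<in> carrier G \<Longrightarrow> inv a \<otimes> g \<in> wball \<rho> \<Longrightarrow> Y' g = w (inv a \<otimes> g)"
      "\<And>g h. g \<in> carrier G \<Longrightarrow> (\<And>b. b \<in> wball R \<Longrightarrow> g \<otimes> b \<in> carrier G) \<Longrightarrow> h \<in> H \<Longrightarrow> Y' (h \<otimes> g) = Y' g"
    then show thesis
      by (rule that)
  qed (use sep Y(2) subgroup.m_closed[OF H] in auto)
  show thesis
  proof (rule that[OF Y'(1)])
    have "Y' \<in> extensional (carrier G)"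
      using Y'(1) subshift_subset[OF subshift] by (auto simp: PiE_def)
    then show "periodic G Y'"
      by (rule periodicI[OF fH]) (use Y'(3) in auto)
    show "Y' g = w g" if "g \<in> F" for g
      using Y'(2)[of \<one> g] subgroup.one_closed[OF H] that F \<rho> by auto
  qed
qed

end

section \<open>Density of the periodic points\<close>

lemma pdim_less_infinity:
  assumes "pdim G S < \<infinity>"
  obtains d where "\<And>r. \<exists>m. \<exists>x\<in>bounded_colorings G S (d + 1) r m. periodic G x"
proof -
  have "{enat d | d. \<forall>r. \<exists>m. \<exists>x \<in> bounded_colorings G S (d + 1) r m. periodic G x} \<noteq> {}"
    using assms unfolding pdim_def by (auto simp: Inf_enat_def split: if_splits)
  then show thesis
    using that by blast
qed

theorem theorem1p4:
  fixes G :: "('g, 'b) monoid_scheme" and S :: "'g set"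
    and A :: "'a set" and X :: "('g \<Rightarrow> 'a) set"
  assumes "group G"
    and "infinite (carrier G)"
    and "finite_symmetric_generators G S"
    and "residually_finite G"
    and "pdim G S < \<infinity>"
    and "finite A"
    and "contractible_subshift G A X"
  shows "(subtopology (full_shift G A) X) closure_of {x \<in> X. periodic G x} = X"
proof
  interpret word_metric G S
    using assms by (simp add: word_metric_def word_metric_axioms_def)
  obtain glue R where "gluing G S A X glue R"
    using contractible_gluing assms(6,7) by blast
  then interpret gluing G S A X glue R .
  have XT: "X \<subseteq> topspace (full_shift G A)"
    using subshift_subset[OF subshift] by (simp add: topspace_full_shift)
  show "(subtopology (full_shift G A) X) closure_of {x \<in> X. periodic G x} \<subseteq> X"
    using closure_of_subset_topspace[of "subtopology (full_shift G A) X"] by auto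
  show "X \<subseteq> (subtopology (full_shift G A) X) closure_of {x \<in> X. periodic G x}"
  proof
    fix w assume w: "w \<in> X"
    have "\<exists>y. y \<in> {x \<in> X. periodic G x} \<and> y \<in> U \<inter> X" if U: "openin (full_shift G A) U" "w \<in> U" for U
    proof -
      obtain F W where F: "finite F" "F \<subseteq> carrier G" and W: "w \<in> W" "W \<subseteq> U"
        "\<And>y z. y \<in> W \<Longrightarrow> z \<in> topspace (full_shift G A) \<Longrightarrow> (\<And>g. g \<in> F \<Longrightarrow> y g = z g) \<Longrightarrow> z \<in> W"
        using openin_full_shift_cylinder[OF U] by metis
      \<comment> \<open>In \<open>pdim\<close> the number of colours is fixed before the scale, so
        the scale may depend on both \<open>d\<close> and \<open>R\<close>.\<close>
      obtain d where "\<And>r. \<exists>m. \<exists>x\<in>bounded_colorings G S (d + 1) r m. periodic G x"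
        using pdim_less_infinity[OF assms(5)] by blast
      then obtain m x where "x \<in> bounded_colorings G S (d + 1) (2 * ((d + 1) * R) + 8 * R) m" "periodic G x"
        by blast
      then obtain Y where Y: "Y \<in> X" "periodic G Y" "\<And>g. g \<in> F \<Longrightarrow> Y g = w g"
        using periodic_point_near[OF assms(4) w F] by metis
      have "Y \<in> W"
        using W(3)[OF W(1)] Y XT by auto
      then show ?thesis
        using Y W by blast
    qed
    then show "w \<in> (subtopology (full_shift G A) X) closure_of {x \<in> X. periodic G x}"
      using w XT by (auto simp: in_closure_of openin_subtopology)
  qed
qed

end
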